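(* Given an instance of $(QP)$, let $\mathcal{K} \in \mathbb{K}$. Then $\ell_{\mathcal{K}}(\cdot)$ is a convex underestimator of $q(\cdot)$ on $S$, i.e., $\ell_{\mathcal{K}}(\cdot)$ is convex on $S$ and \[ \ell_{\mathcal{K}}(\tilde{x}) \le q(\tilde{x}), \quad \tilde{x} \in S. \] Furthermore, \[ \ell_{\mathcal{K}} = \inf_{x \in S} \ell_{\mathcal{K}}(x). \]
   Context: Quadratic program: let $Q \in \mathbb{R}^{n\times n}$ be symmetric, $c \in \mathbb{R}^n$, $A \in \mathbb{R}^{m \times n}$, $b \in \mathbb{R}^m$; put $q(x) = x^T Q x + 2c^T x$ and $S = \{x \in \mathbb{R}^n : Ax = b,\ x \ge 0\}$. $(QP)$ is the problem of minimizing $q(x)$ over $x \in S$. $\mathcal{S}^N$ denotes the real symmetric $N\times N$ matrices, and $\langle U,V\rangle = \sum_{i,j} U_{ij}V_{ij}$. Rows and columns of matrices in $\mathcal{S}^{n+1}$ are indexed by $0,1,\ldots,n$. $\mathcal{CP}^N = \{\sum_{j=1}^k y^j (y^j)^T : k \ge 1,\ y^j \in \mathbb{R}^N_+\}$ is the cone of completely positive matrices, and $\mathcal{P}^{n+1}$ is the cone of positive semidefinite $Y \in \mathcal{S}^{n+1}$ with $Y_{0j} \ge 0$ for $j = 1,\ldots,n$. $\mathbb{K}$ is the family of all closed convex cones $\mathcal{K} \subseteq \mathcal{S}^{n+1}$ with $\mathcal{CP}^{n+1} \subseteq \mathcal{K} \subseteq \mathcal{P}^{n+1}$. Let \[ \widehat{Q}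 = \begin{bmatrix} 0 & c^T \\ c & Q\end{bmatrix}, \qquad \widehat{A} = \begin{bmatrix} b^Tb & -b^TA \\ -A^Tb & A^TA\end{bmatrix}. \] $(P(\mathcal{K}))$: minimize $\langle \widehat{Q}, Y\rangle$ subject to $\langle \widehat{A}, Y\rangle = 0$, $Y_{00} = 1$, $Y \in \mathcal{K}$; its optimal value is $\ell_{\mathcal{K}} \in \mathbb{R}\cup\{-\infty,+\infty\}$. For $\tilde{x} \in S$, $(P(\mathcal{K},\tilde{x}))$ is the same problem with the additional constraint that $(Y_{01},\ldots,Y_{0n}) = \tilde{x}^T$; its optimal value is $\ell_{\mathcal{K}}(\tilde{x}) \in \mathbb{R}\cup\{-\infty,+\infty\}$. Optimal values are infima, with value $+\infty$ for infeasible problems and $-\infty$ for problems unbounded below. Since $\ell_{\mathcal{K}}(\cdot)$ may take the value $-\infty$, convexity on $S$ means that $\{(x,t) \in S \times \mathbb{R} : t \ge \ell_{\mathcal{K}}(x)\}$ is convex. *)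

theory Defs
  imports "HOL-Analysis.Analysis"
begin

text \<open>
  Vectors in $\mathbb{R}^n$ have index type \<open>'n\<close>. The index set $0,1,\ldots,n$ of the lifted
  matrices is \<open>'n option\<close>, where \<open>None\<close> is the index 0 and \<open>Some j\<close> is the index $j$ of
  $\mathbb{R}^n$. The trace inner product of two matrices is the library inner product of
  \<open>real ^ 'N ^ 'N\<close>, which unfolds (by \<open>inner_vec_def\<close>) to the sum of the entrywise products.
\<close>

type_synonym 'N sqmat = "real ^ 'N ^ 'N"

definition sym_mats :: "('N::finite) sqmat set" where
  "sym_mats = {Y. transpose Y = Y}"

definition psd :: "('N::finite) sqmat \<Rightarrow> bool" where
  "psd Y \<longleftrightarrow> Y \<in> sym_mats \<and> (\<forall>v. 0 \<le> v \<bullet> (Y *v v))"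

definition outer :: "real ^ 'N \<Rightarrow> ('N::finite) sqmat" where
  "outer y = (\<chi> i j. y $ i * y $ j)"

definition completely_positive :: "('N::finite) sqmat set" where
  "completely_positive =
     {\<Sum>j=1..k. outer (y j) | (k::nat) (y :: nat \<Rightarrow> real ^ 'N).
        1 \<le> k \<and> (\<forall>j\<in>{1..k}. \<forall>i. 0 \<le> y j $ i)}"

definition psd_nonneg_row :: "(('n::finite) option) sqmat set" where
  "psd_nonneg_row = {Y. psd Y \<and> (\<forall>j. 0 \<le> Y $ None $ Some j)}"

definition cone_family :: "(('n::finite) option) sqmat set set" where
  "cone_family =
     {K. K \<subseteq> sym_mats \<and> closed K \<and> convex_cone K \<and>
         completely_positive \<subseteq> K \<and> K \<subseteq> psd_nonneg_row}"

text \<open>The block matrix with rows $(\alpha, u^T)$ and $(u, M)$.\<close>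

definition bordered :: "real \<Rightarrow> real ^ 'n \<Rightarrow> real ^ 'n ^ 'n \<Rightarrow> (('n::finite) option) sqmat" where
  "bordered \<alpha> u M =
     (\<chi> i j. case i of
        None \<Rightarrow> (case j of None \<Rightarrow> \<alpha> | Some l \<Rightarrow> u $ l)
      | Some k \<Rightarrow> (case j of None \<Rightarrow> u $ k | Some l \<Rightarrow> M $ k $ l))"

definition Q_hat :: "real ^ 'n ^ 'n \<Rightarrow> real ^ 'n \<Rightarrow> (('n::finite) option) sqmat" where
  "Q_hat Q c = bordered 0 c Q"

definition A_hat :: "real ^ 'n ^ 'm \<Rightarrow> real ^ 'm \<Rightarrow> (('n::finite) option) sqmat" where
  "A_hat A b = bordered (b \<bullet> b) (- (transpose A *v b)) (transpose A ** A)"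

definition qp_obj :: "real ^ 'n ^ 'n \<Rightarrow> real ^ 'n \<Rightarrow> real ^ ('n::finite) \<Rightarrow> real" where
  "qp_obj Q c x = x \<bullet> (Q *v x) + 2 * (c \<bullet> x)"

definition qp_feasible :: "real ^ 'n ^ 'm \<Rightarrow> real ^ 'm \<Rightarrow> (real ^ ('n::finite)) set" where
  "qp_feasible A b = {x. A *v x = b \<and> (\<forall>j. 0 \<le> x $ j)}"

definition relax_feasible ::
  "real ^ 'n ^ 'm \<Rightarrow> real ^ 'm \<Rightarrow> (('n::finite) option) sqmat set \<Rightarrow> ('n option) sqmat set" where
  "relax_feasible A b K = {Y \<in> K. A_hat A b \<bullet> Y = 0 \<and> Y $ None $ None = 1}"

text \<open>
  Optimal values are infima in the extended reals, where the infimum of the empty set is \<open>\<infinity>\<close>.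
\<close>

definition relax_value ::
  "real ^ 'n ^ 'n \<Rightarrow> real ^ 'n \<Rightarrow> real ^ 'n ^ 'm \<Rightarrow> real ^ 'm \<Rightarrow>
     (('n::finite) option) sqmat set \<Rightarrow> ereal" where
  "relax_value Q c A b K = (INF Y\<in>relax_feasible A b K. ereal (Q_hat Q c \<bullet> Y))"

definition relax_value_at ::
  "real ^ 'n ^ 'n \<Rightarrow> real ^ 'n \<Rightarrow> real ^ 'n ^ 'm \<Rightarrow> real ^ 'm \<Rightarrow>
     (('n::finite) option) sqmat set \<Rightarrow> real ^ 'n \<Rightarrow> ereal" where
  "relax_value_at Q c A b K x =
     (INF Y\<in>{Y \<in> relax_feasible A b K. \<forall>j. Y $ None $ Some j = x $ j}. ereal (Q_hat Q c \<bullet> Y))"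

text \<open>
  Convexity of an extended-real-valued function, stated through the epigraph because the value
  \<open>-\<infinity>\<close> may occur.
\<close>

definition ereal_convex_on :: "'a::real_vector set \<Rightarrow> ('a \<Rightarrow> ereal) \<Rightarrow> bool" where
  "ereal_convex_on S f \<longleftrightarrow> convex {(x, t::real). x \<in> S \<and> f x \<le> ereal t}"

end

theory Submission
  imports Defs
begin

text \<open>
  The matrix \<open>A_hat\<close> is the sum over the rows of $A$ of $w_i w_i^T$ with $w_i = (-b_i, a_i)$, so for
  positive semidefinite $Y$ the constraint $\langle\widehat{A},Y\rangle = 0$ forces
  $w_i^T Y w_i = 0$ and hence $Y w_i = 0$ for each $i$. Row 0 of these equations says that the first
  row of $Y$ satisfies $Ax = b$: every feasible $Y$ has its first row in $S$, which splits the
  relaxation into its slices. Convexity holds because feasible matrices with given first rows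
  are closed under convex combinations, and $q(x)$ is the value of the rank-one matrix built from
  $(1,x)$.
\<close>

text \<open>The head entry is arbitrary because two kinds of vectors are lifted: points
  \<open>x\<close> with head 1, and rows of \<open>A\<close> with head
  \<open>- b $ i\<close>.\<close>

definition lift_vec :: "real \<Rightarrow> real ^ 'n \<Rightarrow> real ^ ('n::finite) option" where
  "lift_vec \<alpha> x = (\<chi> k. case k of None \<Rightarrow> \<alpha> | Some j \<Rightarrow> x $ j)"

lemma lift_vec_nth [simp]:
  "lift_vec \<alpha> x $ None = \<alpha>"
  "lift_vec \<alpha> x $ Some j = x $ j"
  by (simp_all add: lift_vec_def)

lemma sum_UNIV_option:
  fixes f :: "'a::finite option \<Rightarrow> 'b::comm_monoid_add"
  shows "(\<Sum>k\<in>UNIV. f k) = f None + (\<Sum>j\<in>UNIV. f (Some j))"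
  by (simp add: UNIV_option_conv sum.reindex)

lemma inner_lift_vec: "lift_vec \<alpha> x \<bullet> lift_vec \<beta> y = \<alpha> * \<beta> + x \<bullet> y"
  by (simp add: inner_vec_def sum_UNIV_option)

lemma inner_outer: "outer v \<bullet> Y = v \<bullet> (Y *v v)"
  by (simp add: outer_def inner_vec_def matrix_vector_mult_def sum_distrib_left mult_ac)

lemma bordered_mult_lift_vec:
  "bordered \<alpha> u M *v lift_vec \<beta> x = lift_vec (\<alpha> * \<beta> + u \<bullet> x) (\<beta> *\<^sub>R u + M *v x)"
proof -
  have "(bordered \<alpha> u M *v lift_vec \<beta> x) $ k
      = lift_vec (\<alpha> * \<beta> + u \<bullet> x) (\<beta> *\<^sub>R u + M *v x) $ k" for k
    by (cases k) (simp_all add: matrix_vector_mult_def sum_UNIV_option bordered_def inner_vec_def)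
  then show ?thesis
    by (simp add: vec_eq_iff)
qed

text \<open>Evaluates both data matrices at the rank-one lift of \<open>x\<close>:
  \<open>Q_hat\<close> yields q(x), and \<open>A_hat\<close> yields the squared norm of Ax - b in
  expanded form.\<close>

lemma inner_bordered_outer:
  "bordered \<alpha> u M \<bullet> outer (lift_vec 1 x) = \<alpha> + 2 * (u \<bullet> x) + x \<bullet> (M *v x)"
  by (simp add: inner_commute[of "bordered \<alpha> u M"] inner_outer bordered_mult_lift_vec
      inner_lift_vec inner_add_right inner_commute[of x u])

lemma A_hat_eq_sum_outer:
  "A_hat A b = (\<Sum>i\<in>UNIV. outer (lift_vec (- b $ i) (A $ i)))"
proof -
  have "A_hat A b $ k $ l = (\<Sum>i\<in>UNIV. outer (lift_vec (- b $ i) (A $ i))) $ k $ l" for k l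
    by (cases k; cases l)
      (simp_all add: A_hat_def bordered_def outer_def inner_vec_def transpose_def
        matrix_vector_mult_def matrix_matrix_mult_def sum_negf mult_ac)
  then show ?thesis
    by (simp add: vec_eq_iff)
qed

lemma A_hat_inner:
  "A_hat A b \<bullet> Y = (\<Sum>i\<in>UNIV. lift_vec (- b $ i) (A $ i) \<bullet> (Y *v lift_vec (- b $ i) (A $ i)))"
  by (simp add: A_hat_eq_sum_outer inner_sum_left inner_outer)

text \<open>Moving from \<open>w\<close> in direction z = Yw changes the form by a linear term
  2t|z|^2 and a quadratic one. For small negative t the linear term would win and make the form
  negative unless z = 0.\<close>

lemma psd_quadratic_form_zero:
  assumes "psd Y" and zero: "w \<bullet> (Y *v w) = 0"
  shows "Y *v w = 0"
proof -
  define z where "z = Y *v w"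
  have sym: "transpose Y = Y" and nonneg: "\<And>v. 0 \<le> v \<bullet> (Y *v v)"
    using \<open>psd Y\<close> by (auto simp: psd_def sym_mats_def)
  \<comment> \<open>Symmetry of \<open>Y\<close> moves it from \<open>z\<close> onto
    \<open>w\<close>, where it produces \<open>z\<close> again.\<close>
  have cross: "w \<bullet> (Y *v z) = z \<bullet> z"
    by (metis z_def sym dot_lmul_matrix inner_commute transpose_matrix_vector)
  have "0 \<le> 2 * t * (z \<bullet> z) + t\<^sup>2 * (z \<bullet> (Y *v z))" for t
    using nonneg[of "w + t *\<^sub>R z"] zero cross
    by (simp add: matrix_vector_right_distrib matrix_vector_mult_scaleR inner_add_left
        inner_add_right z_def[symmetric] power2_eq_square algebra_simps)
  then have quad: "0 \<le> - 2 * s * (z \<bullet> z) + s\<^sup>2 * (z \<bullet> (Y *v z))" for s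
    by (metis mult_minus_left mult_minus_right power2_minus)
  have "z \<bullet> z = 0"
  proof (rule ccontr)
    assume "z \<bullet> z \<noteq> 0"
    then have pos: "0 < z \<bullet> z" by simp
    define p where "p = z \<bullet> (Y *v z)"
    have p: "0 \<le> p" using nonneg p_def by simp
    \<comment> \<open>The denominator \<open>p + 1\<close> stays positive even if \<open>p\<close>
      is 0, and it makes the quadratic term at most half the size of the linear one.\<close>
    define s where "s = (z \<bullet> z) / (p + 1)"
    have s: "0 < s" "s * p \<le> z \<bullet> z"
      using pos p by (simp_all add: s_def divide_simps)
    have "s * (s * p) \<le> s * (z \<bullet> z)" using s by (intro mult_left_mono) auto
    moreover have "0 < s * (z \<bullet> z)" using s pos by simp
    ultimately show False
      using quad[of s] by (simp add: p_def[symmetric] power2_eq_square mult.assoc)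
  qed
  then show ?thesis by (simp add: z_def)
qed

lemma first_row_feasible:
  assumes K: "K \<in> cone_family" and Y: "Y \<in> relax_feasible A b K"
  shows "(\<chi> j. Y $ None $ Some j) \<in> qp_feasible A b"
proof -
  define w where "w i = lift_vec (- b $ i) (A $ i)" for i
  define x where "x = (\<chi> j. Y $ None $ Some j)"
  have "Y \<in> psd_nonneg_row" and zero: "A_hat A b \<bullet> Y = 0" and one: "Y $ None $ None = 1"
    using K Y by (auto simp: cone_family_def relax_feasible_def)
  then have psd: "psd Y" and x0: "\<And>j. 0 \<le> x $ j"
    by (simp_all add: psd_nonneg_row_def x_def)
  have "(A *v x) $ i = b $ i" for i
  proof -
    have nonneg: "0 \<le> w k \<bullet> (Y *v w k)" for k
      using psd by (simp add: psd_def)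
    have "(\<Sum>k\<in>UNIV. w k \<bullet> (Y *v w k)) = 0"
      using zero by (simp add: A_hat_inner w_def)
    then have "w i \<bullet> (Y *v w i) = 0"
      using nonneg by (simp add: sum_nonneg_eq_0_iff)
    then have "Y *v w i = 0"
      by (rule psd_quadratic_form_zero[OF psd])
    \<comment> \<open>This entry is -b_i Y_00 + a_i^T x, and Y_00 = 1.\<close>
    then have "(Y *v w i) $ None = 0" by simp
    then show ?thesis
      by (simp add: matrix_vector_mult_def sum_UNIV_option w_def one x_def mult_ac)
  qed
  then show ?thesis
    using x0 by (simp add: qp_feasible_def vec_eq_iff x_def[symmetric])
qed

lemma outer_completely_positive:
  assumes "\<And>i. 0 \<le> y $ i"
  shows "outer y \<in> completely_positive"
  unfolding completely_positive_def
  by (rule CollectI, rule exI[of _ 1], rule exI[of _ "\<lambda>_. y"]) (simp add: assms)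

text \<open>The lift is completely positive, so it lies in every cone of the family.\<close>

lemma outer_lift_feasible:
  assumes K: "K \<in> cone_family" and x: "x \<in> qp_feasible A b"
  shows "outer (lift_vec 1 x) \<in> relax_feasible A b K"
proof -
  have "0 \<le> lift_vec 1 x $ k" for k
    using x by (cases k) (auto simp: qp_feasible_def)
  then have "outer (lift_vec 1 x) \<in> K"
    using K outer_completely_positive by (auto simp: cone_family_def)
  moreover have "A_hat A b \<bullet> outer (lift_vec 1 x) = 0"
  proof -
    \<comment> \<open>With Ax = b, the three terms of |Ax - b|^2 become 1, -2 and 1 times
      \<open>b \<bullet> b\<close>.\<close>
    have "x \<bullet> (transpose A *v (A *v x)) = b \<bullet> b" "(transpose A *v b) \<bullet> x = b \<bullet> b"
      using x by (simp_all add: qp_feasible_def dot_lmul_matrix[symmetric]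
          transpose_matrix_vector dot_lmul_matrix inner_commute[of x])
    then show ?thesis
      by (simp add: A_hat_def inner_bordered_outer matrix_vector_mul_assoc[symmetric])
  qed
  ultimately show ?thesis
    by (simp add: relax_feasible_def) (simp add: outer_def)
qed

text \<open>The lift of \<open>x\<close> competes in the infimum with objective value exactly
  q(x).\<close>

lemma relax_value_at_le_obj:
  assumes "K \<in> cone_family" and "x \<in> qp_feasible A b"
  shows "relax_value_at Q c A b K x \<le> ereal (qp_obj Q c x)"
  unfolding relax_value_at_def
proof (rule INF_lower2)
  show "outer (lift_vec 1 x) \<in> {Y \<in> relax_feasible A b K. \<forall>j. Y $ None $ Some j = x $ j}"
    using outer_lift_feasible[OF assms] by (simp add: outer_def)
  show "ereal (Q_hat Q c \<bullet> outer (lift_vec 1 x)) \<le> ereal (qp_obj Q c x)"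
    by (simp add: Q_hat_def inner_bordered_outer qp_obj_def)
qed

text \<open>The infimum may be unattained or equal to -\<infinity>; the slack \<open>e\<close> makes
  the inequality strict and so provides an actual feasible matrix in both cases.\<close>

lemma relax_value_at_le_approx:
  assumes "relax_value_at Q c A b K x \<le> ereal t" and "0 < e"
  obtains Y where "Y \<in> relax_feasible A b K" "\<And>j. Y $ None $ Some j = x $ j"
    "Q_hat Q c \<bullet> Y < t + e"
proof -
  have "relax_value_at Q c A b K x < ereal (t + e)"
    using assms by (intro order.strict_trans1[OF assms(1)]) simp
  then show ?thesis
    unfolding relax_value_at_def INF_less_iff using that by auto
qed

lemma convex_relax_feasible:
  assumes "convex K"
  shows "convex (relax_feasible A b K)"
  using assms unfolding convex_def relax_feasible_def by (auto simp: inner_add_right)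

lemma convex_qp_feasible: "convex (qp_feasible A b)"
  unfolding convex_def qp_feasible_def
  by (auto simp: matrix_vector_right_distrib matrix_vector_mult_scaleR scaleR_left_distrib[symmetric])

text \<open>Nearly optimal matrices at the two points are mixed with the same weights; the first row
  of the mixture is the mixed point.\<close>

lemma relax_value_at_convex:
  assumes "convex K"
  shows "ereal_convex_on (qp_feasible A b) (relax_value_at Q c A b K)"
  unfolding ereal_convex_on_def
proof (rule convexI, clarsimp, rule conjI)
  fix x t y s and u v :: real
  assume x: "x \<in> qp_feasible A b" "relax_value_at Q c A b K x \<le> ereal t"
    and y: "y \<in> qp_feasible A b" "relax_value_at Q c A b K y \<le> ereal s"
    and uv: "0 \<le> u" "0 \<le> v" "u + v = 1"
  show "u *\<^sub>R x + v *\<^sub>R y \<in> qp_feasible A b"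
    using convexD[OF convex_qp_feasible] x y uv by blast
  show "relax_value_at Q c A b K (u *\<^sub>R x + v *\<^sub>R y) \<le> ereal (u * t + v * s)"
  proof (rule ereal_le_epsilon2)
    fix e :: real
    assume "0 < e"
    obtain Y where Y: "Y \<in> relax_feasible A b K" "\<And>j. Y $ None $ Some j = x $ j"
      "Q_hat Q c \<bullet> Y < t + e"
      using relax_value_at_le_approx[OF x(2) \<open>0 < e\<close>] by blast
    obtain Z where Z: "Z \<in> relax_feasible A b K" "\<And>j. Z $ None $ Some j = y $ j"
      "Q_hat Q c \<bullet> Z < s + e"
      using relax_value_at_le_approx[OF y(2) \<open>0 < e\<close>] by blast
    have mem: "u *\<^sub>R Y + v *\<^sub>R Z \<in> relax_feasible A b K"
      using convexD[OF convex_relax_feasible[OF assms]] Y(1) Z(1) uv by blast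
    have "Q_hat Q c \<bullet> (u *\<^sub>R Y + v *\<^sub>R Z) \<le> u * (t + e) + v * (s + e)"
      using Y(3) Z(3) uv by (auto simp: inner_add_right intro!: add_mono mult_left_mono)
    \<comment> \<open>The weights sum to 1, so the two slacks combine to a single
      \<open>e\<close>.\<close>
    also have "\<dots> = u * t + v * s + e"
    proof -
      have "u * (t + e) + v * (s + e) = u * t + v * s + (u + v) * e"
        by (simp add: algebra_simps)
      then show ?thesis using uv(3) by simp
    qed
    finally have "ereal (Q_hat Q c \<bullet> (u *\<^sub>R Y + v *\<^sub>R Z)) \<le> ereal (u * t + v * s) + ereal e"
      by simp
    then show "relax_value_at Q c A b K (u *\<^sub>R x + v *\<^sub>R y) \<le> ereal (u * t + v * s) + ereal e"
      unfolding relax_value_at_def using mem Y(2) Z(2) by (intro INF_lower2) auto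
  qed
qed

text \<open>Each slice is part of the full feasible set, which gives one inequality. Conversely,
  every feasible \<open>Y\<close> belongs to the slice at its own first row, a point of S by
  \<open>first_row_feasible\<close>.\<close>

lemma relax_value_eq_INF:
  assumes "K \<in> cone_family"
  shows "relax_value Q c A b K = (INF x\<in>qp_feasible A b. relax_value_at Q c A b K x)"
proof (rule antisym)
  show "relax_value Q c A b K \<le> (INF x\<in>qp_feasible A b. relax_value_at Q c A b K x)"
    unfolding relax_value_def relax_value_at_def
    by (intro INF_greatest INF_lower) auto
  show "(INF x\<in>qp_feasible A b. relax_value_at Q c A b K x) \<le> relax_value Q c A b K"
    unfolding relax_value_def
  proof (rule INF_greatest)
    fix Y
    assume Y: "Y \<in> relax_feasible A b K"
    show "(INF x\<in>qp_feasible A b. relax_value_at Q c A b K x) \<le> ereal (Q_hat Q c \<bullet> Y)"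
      using first_row_feasible[OF assms Y]
    proof (rule INF_lower2)
      show "relax_value_at Q c A b K (\<chi> j. Y $ None $ Some j) \<le> ereal (Q_hat Q c \<bullet> Y)"
        unfolding relax_value_at_def using Y by (intro INF_lower) simp
    qed
  qed
qed

theorem proposition3p1:
  fixes Q :: "real ^ 'n::finite ^ 'n" and c :: "real ^ 'n"
    and A :: "real ^ 'n ^ 'm::finite" and b :: "real ^ 'm"
    and K :: "('n option) sqmat set"
  assumes "Q \<in> sym_mats"
    and "K \<in> cone_family"
  shows "ereal_convex_on (qp_feasible A b) (relax_value_at Q c A b K)
    \<and> (\<forall>x\<in>qp_feasible A b. relax_value_at Q c A b K x \<le> ereal (qp_obj Q c x))
    \<and> relax_value Q c A b K = (INF x\<in>qp_feasible A b. relax_value_at Q c A b K x)"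
proof -
  have "convex K"
    using assms(2) by (simp add: cone_family_def convex_cone_def)
  then show ?thesis
    using relax_value_at_convex relax_value_at_le_obj[OF assms(2)] relax_value_eq_INF[OF assms(2)]
    by blast
qed

end
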